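(* For every integer $n\ge 0$, $$F_{2n+2}=1\cdot\sum_{i=0}^{n}1^{n-i}F_{2i+1}=1\cdot\sum_{i=0}^{n}(-1)^{n-i}L_{2i+1},$$ $$F_{3n+3}=2\cdot\sum_{i=0}^{n}1^{n-i}F_{3i+1}=2\cdot\sum_{i=0}^{n}(-3)^{n-i}L_{3i+1},$$ $$F_{4n+4}=3\cdot\sum_{i=0}^{n}2^{n-i}F_{4i+1}=3\cdot\sum_{i=0}^{n}(-4)^{n-i}L_{4i+1}.$$
   Context: $F_n$ denotes the Fibonacci numbers: $F_0=0$, $F_1=1$, $F_n=F_{n-1}+F_{n-2}$. $L_n$ denotes the Lucas numbers: $L_0=2$, $L_1=1$, $L_n=L_{n-1}+L_{n-2}$. *)

theory Defs
  imports "HOL-Number_Theory.Fib"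
begin

fun lucas :: "nat \<Rightarrow> nat" where
  "lucas 0 = 2"
| "lucas (Suc 0) = 1"
| "lucas (Suc (Suc n)) = lucas (Suc n) + lucas n"

end

theory Submission
  imports Defs
begin

text \<open>
  All six equalities are one phenomenon. Fix a step \<open>k + 1\<close> and follow the Fibonacci numbers along
  the multiples of \<open>k + 1\<close>. The addition formula
  \<open>F\<^sub>m\<^sub>+\<^sub>k\<^sub>+\<^sub>1 = F\<^sub>k F\<^sub>m + F\<^sub>k\<^sub>+\<^sub>1 F\<^sub>m\<^sub>+\<^sub>1\<close>
  says that this subsequence solves a first-order linear recurrence with multiplier
  \<open>F\<^sub>k\<close> and source term \<open>F\<^sub>k\<^sub>+\<^sub>1 F\<^sub>m\<^sub>+\<^sub>1\<close>. Replacing \<open>F\<^sub>m\<^sub>+\<^sub>1\<close> in the source by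
  \<open>L\<^sub>m\<^sub>+\<^sub>1 = F\<^sub>m\<^sub>+\<^sub>1 + 2 F\<^sub>m\<close> changes the multiplier to
  \<open>F\<^sub>k - 2 F\<^sub>k\<^sub>+\<^sub>1 = - L\<^sub>k\<close>. Unrolling each of the two recurrences from \<open>F\<^sub>0 = 0\<close>
  (lemma \<open>linear_recurrence_solution\<close>) gives
  \<open>F\<^sub>k\<^sub>+\<^sub>1\<close> times a sum with powers of \<open>F\<^sub>k\<close>, respectively of \<open>- L\<^sub>k\<close>, for every \<open>k\<close>.
  The theorem is the case \<open>k = 1, 2, 3\<close>, where \<open>F\<^sub>k = 1, 1, 2\<close>, \<open>F\<^sub>k\<^sub>+\<^sub>1 = 1, 2, 3\<close> and
  \<open>L\<^sub>k = 1, 3, 4\<close>.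
\<close>

text \<open>
  The index of \<open>x\<close> runs one ahead of that of \<open>a\<close>, so that the initial value \<open>0\<close> leaves no
  homogeneous term.
\<close>
lemma linear_recurrence_solution:
  fixes x a :: "nat \<Rightarrow> 'a::comm_semiring_1"
  assumes "x 0 = 0" and "\<And>n. x (Suc n) = r * x n + c * a n"
  shows "x (Suc n) = c * (\<Sum>i=0..n. r ^ (n - i) * a i)"
proof (induction n)
  case 0
  then show ?case using assms by simp
next
  case (Suc n)
  have "(\<Sum>i=0..n. r ^ (Suc n - i) * a i) = r * (\<Sum>i=0..n. r ^ (n - i) * a i)"
    by (simp add: sum_distrib_left Suc_diff_le mult.assoc)
  then show ?case
    using assms(2)[of "Suc n"] Suc.IH by (simp add: algebra_simps)
qed

text \<open>
  This form of \<open>L\<^sub>n = F\<^sub>n\<^sub>-\<^sub>1 + F\<^sub>n\<^sub>+\<^sub>1\<close> avoids the index \<open>n - 1\<close>, so it also covers \<open>n = 0\<close>.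
\<close>
lemma lucas_eq_fib: "int (lucas n) = 2 * int (fib (Suc n)) - int (fib n)"
  by (induction n rule: lucas.induct) simp_all

lemma fib_add_int:
  "int (fib (m + Suc k)) = int (fib k) * int (fib m) + int (fib (Suc k)) * int (fib (Suc m))"
  using fib_add[of k m] by (simp add: add.commute mult.commute)

text \<open>
  The coefficient of \<open>F\<^sub>m\<close> is whatever compensates for \<open>L\<^sub>m\<^sub>+\<^sub>1\<close> exceeding \<open>F\<^sub>m\<^sub>+\<^sub>1\<close> by \<open>2 F\<^sub>m\<close>; that
  it is again a Lucas number is \<open>lucas_eq_fib\<close>, used a second time at \<open>k\<close>.
\<close>
lemma fib_add_lucas:
  "int (fib (m + Suc k)) = - int (lucas k) * int (fib m) + int (fib (Suc k)) * int (lucas (Suc m))"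
  by (simp only: fib_add_int lucas_eq_fib) (simp add: algebra_simps)

lemma fib_multiple_eq_sum_fib:
  "int (fib (Suc k * Suc n))
     = int (fib (Suc k)) * (\<Sum>i=0..n. int (fib k) ^ (n - i) * int (fib (Suc (Suc k * i))))"
  by (rule linear_recurrence_solution[where x = "\<lambda>n. int (fib (Suc k * n))"])
     (simp, subst fib_add_int[symmetric], simp add: algebra_simps)

lemma fib_multiple_eq_sum_lucas:
  "int (fib (Suc k * Suc n))
     = int (fib (Suc k)) * (\<Sum>i=0..n. (- int (lucas k)) ^ (n - i) * int (lucas (Suc (Suc k * i))))"
  by (rule linear_recurrence_solution[where x = "\<lambda>n. int (fib (Suc k * n))"])
     (simp, subst fib_add_lucas[symmetric], simp add: algebra_simps)

theorem mainTheorem3: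
  fixes n :: nat
  shows "(int (fib (2 * n + 2)) = 1 * (\<Sum>i=0..n. 1 ^ (n - i) * int (fib (2 * i + 1))) \<and>
          1 * (\<Sum>i=0..n. 1 ^ (n - i) * int (fib (2 * i + 1)))
            = 1 * (\<Sum>i=0..n. (- 1) ^ (n - i) * int (lucas (2 * i + 1)))) \<and>
         (int (fib (3 * n + 3)) = 2 * (\<Sum>i=0..n. 1 ^ (n - i) * int (fib (3 * i + 1))) \<and>
          2 * (\<Sum>i=0..n. 1 ^ (n - i) * int (fib (3 * i + 1)))
            = 2 * (\<Sum>i=0..n. (- 3) ^ (n - i) * int (lucas (3 * i + 1)))) \<and>
         (int (fib (4 * n + 4)) = 3 * (\<Sum>i=0..n. 2 ^ (n - i) * int (fib (4 * i + 1))) \<and>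
          3 * (\<Sum>i=0..n. 2 ^ (n - i) * int (fib (4 * i + 1)))
            = 3 * (\<Sum>i=0..n. (- 4) ^ (n - i) * int (lucas (4 * i + 1))))"
proof -
  have small_values: "fib 1 = 1" "fib 2 = 1" "fib 3 = 2" "fib 4 = 3" "lucas 1 = 1" "lucas 2 = 3" "lucas 3 = 4"
    by (simp_all add: numeral_eq_Suc)
  have indices: "2 * n + 2 = Suc 1 * Suc n" "3 * n + 3 = Suc 2 * Suc n" "4 * n + 4 = Suc 3 * Suc n"
    by simp_all
  show ?thesis
    unfolding indices Suc_eq_plus1[symmetric]
    using fib_multiple_eq_sum_fib[of 1 n] fib_multiple_eq_sum_lucas[of 1 n]
      fib_multiple_eq_sum_fib[of 2 n] fib_multiple_eq_sum_lucas[of 2 n]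
      fib_multiple_eq_sum_fib[of 3 n] fib_multiple_eq_sum_lucas[of 3 n]
    by (simp add: small_values del: One_nat_def mult_Suc_right)
qed

end
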